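(* Assume (A1) and (A2) as stated in the context. For every $\theta\in\Theta$, let $u_h(\theta),\psi_h(\theta)$ be the high-fidelity state and adjoint, $u_r(\theta),\psi_r(\theta)$ the reduced basis state and adjoint, $e_r^u=u_h-u_r$, $e_r^\psi=\psi_h-\psi_r$, $e_r^\eta(\theta)=\eta_y(u_h(\theta))-\eta_y(u_r(\theta))$, and $e_r^\Delta(\theta)=\eta_y(u_h(\theta))-\eta_y^\Delta(\theta)$, where $\eta_y^\Delta(\theta)=\eta_y(u_r(\theta))+A(u_r(\theta),\psi_r(\theta);\theta)-F(\psi_r(\theta);\theta)$. Then $$|e_r^\eta(\theta)|\le (C_y+C_{\mathcal O}C_u(\theta))\,\|e_r^u(\theta)\|_V$$ and $$|e_r^\Delta(\theta)|\le \gamma(\theta)\,\|e_r^u(\theta)\|_V\|e_r^\psi(\theta)\|_V+\tfrac12 C_{\mathcal O}\|e_r^u(\theta)\|_V^2 .$$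
   Context: Setting. $V$ is a real Hilbert space with dual $V'$; $\Theta\subset\mathbb R^d$ is the parameter set; for each $\theta\in\Theta$, $A(\cdot,\cdot;\theta):V\times V\to\mathbb R$ is bilinear and $F(\cdot;\theta):V\to\mathbb R$ is linear. $\mathcal O=(o_1,\dots,o_s)$ with $o_i\in V'$, $\|\mathcal O\|_{V'}:=(\sum_i\|o_i\|_{V'}^2)^{1/2}$; $y\in\mathbb R^s$; $\Gamma\in\mathbb R^{s\times s}$ is symmetric positive definite. The potential is $\eta_y(u)=\frac12(y-\mathcal O(u))^T\Gamma^{-1}(y-\mathcal O(u))$ for $u\in V$, with derivative $\nabla_u\eta_y|_u(w)=-(y-\mathcal O(u))^T\Gamma^{-1}\mathcal O(w)$. Assumptions. (A1) For every $\theta\in\Theta$ there are $\alpha(\theta)>0$, $\gamma(\theta)>0$ with $\alpha(\theta)\|w\|_V^2\le A(w,w;\theta)$ and $A(w,v;\theta)\le\gamma(\theta)\|w\|_V\|v\|_V$ for all $w,v\in V$, and $\|F(\cdot;\theta)\|_{V'}<\infty$. (A2) $A(\cdot,\cdot;\theta)$ and $F(\cdot;\theta)$ are continuously differentiable in $\theta$ at every $\theta\in\Theta$, and for each $j=1,\dots,d$ there is $0<\rho_j(\theta)<\infty$ with $\partial_{\theta_j}A(w,v;\theta)\le\rho_j(\theta)\|w\|_V\|v\|_V$ for all $w,v\in V$, and $\|\partial_{\theta_j}F(\cdot;\theta)\|_{V'}<\infty$. Discrete problems. $V_h\subset V$ is a finite-dimensional subspace; $V_r,W_r\subset V_h$ are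 subspaces (all independent of $\theta$). For each $\theta$: $u_h\in V_h$ solves $A(u_h,v;\theta)=F(v;\theta)$ for all $v\in V_h$; $\psi_h\in V_h$ solves $A(w,\psi_h;\theta)=-\nabla_u\eta_y|_{u_h}(w)$ for all $w\in V_h$; $u_r\in V_r$ solves $A(u_r,v;\theta)=F(v;\theta)$ for all $v\in V_r$; $\psi_r\in W_r$ solves $A(w,\psi_r;\theta)=-\nabla_u\eta_y|_{u_r}(w)$ for all $w\in W_r$. Constants. $C_y:=\|\Gamma^{-1}\|_2\|\mathcal O\|_{V'}\|y\|_2$, $C_{\mathcal O}:=\|\Gamma^{-1}\|_2\|\mathcal O\|_{V'}^2$ (spectral and Euclidean norms), $C_u(\theta):=\|F(\cdot;\theta)\|_{V'}/\alpha(\theta)$. *)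

theory Defs
  imports "HOL-Analysis.Analysis"
begin

text \<open>
  The Hilbert space \<open>V\<close> is a type of class \<open>{real_inner, complete_space}\<close>; an element of the
  dual \<open>V'\<close> is a function satisfying \<^const>\<open>bounded_linear\<close>, and its dual norm is
  \<^const>\<open>onorm\<close>. As \<^const>\<open>onorm\<close> is a real number, the condition that a linear functional
  has finite dual norm is always stated as \<^const>\<open>bounded_linear\<close>.
\<close>

definition sym_pos_def :: "real^'s^'s \<Rightarrow> bool" where
  "sym_pos_def G \<longleftrightarrow> transpose G = G \<and> (\<forall>x. x \<noteq> 0 \<longrightarrow> x \<bullet> (G *v x) > 0)"

definition spectral_norm :: "real^'s^'s \<Rightarrow> real" where
  "spectral_norm M = onorm ((*v) M)"

definition observe :: "('s \<Rightarrow> 'v \<Rightarrow> real) \<Rightarrow> 'v \<Rightarrow> real^'s" where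
  "observe ob u = (\<chi> i. ob i u)"

definition obs_norm :: "('s::finite \<Rightarrow> 'v::real_normed_vector \<Rightarrow> real) \<Rightarrow> real" where
  "obs_norm ob = sqrt (\<Sum>i\<in>UNIV. (onorm (ob i))\<^sup>2)"

definition potential ::
  "real^'s^'s \<Rightarrow> ('s::finite \<Rightarrow> 'v \<Rightarrow> real) \<Rightarrow> real^'s \<Rightarrow> 'v \<Rightarrow> real" where
  "potential G ob y u = (y - observe ob u) \<bullet> (matrix_inv G *v (y - observe ob u)) / 2"

text \<open>
  The derivative of the potential at \<open>u\<close> in direction \<open>w\<close>; see
  \<open>potential_has_derivative\<close> below.
\<close>

definition potential_deriv ::
  "real^'s^'s \<Rightarrow> ('s::finite \<Rightarrow> 'v \<Rightarrow> real) \<Rightarrow> real^'s \<Rightarrow> 'v \<Rightarrow> 'v \<Rightarrow> real" where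
  "potential_deriv G ob y u w = - ((y - observe ob u) \<bullet> (matrix_inv G *v observe ob w))"

definition assumption_A1 ::
  "'t set \<Rightarrow> ('t \<Rightarrow> 'v::real_inner \<Rightarrow> 'v \<Rightarrow> real) \<Rightarrow> ('t \<Rightarrow> 'v \<Rightarrow> real) \<Rightarrow>
    ('t \<Rightarrow> real) \<Rightarrow> ('t \<Rightarrow> real) \<Rightarrow> bool" where
  "assumption_A1 \<Theta> A F \<alpha> \<gamma> \<longleftrightarrow>
    (\<forall>\<theta>\<in>\<Theta>. \<alpha> \<theta> > 0 \<and> \<gamma> \<theta> > 0 \<and>
      (\<forall>w. \<alpha> \<theta> * (norm w)\<^sup>2 \<le> A \<theta> w w) \<and>
      (\<forall>w v. A \<theta> w v \<le> \<gamma> \<theta> * norm w * norm v) \<and>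
      bounded_linear (F \<theta>))"

text \<open>
  \<open>f\<close> is continuously differentiable on \<open>\<Theta>\<close> with partial derivatives \<open>df j\<close>. No
  structure of \<open>\<Theta>\<close> is assumed, so derivatives are taken within \<open>\<Theta>\<close>; for open \<open>\<Theta>\<close>
  this is the usual notion and the \<open>df j\<close> are uniquely determined on \<open>\<Theta>\<close>.
\<close>

definition C1_partials_on ::
  "(real^'d) set \<Rightarrow> (real^'d \<Rightarrow> real) \<Rightarrow> ('d::finite \<Rightarrow> real^'d \<Rightarrow> real) \<Rightarrow> bool" where
  "C1_partials_on \<Theta> f df \<longleftrightarrow>
    (\<forall>\<theta>\<in>\<Theta>. (f has_derivative (\<lambda>h. \<Sum>j\<in>UNIV. df j \<theta> * h $ j)) (at \<theta> within \<Theta>)) \<and>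
    (\<forall>j. continuous_on \<Theta> (df j))"

text \<open>
  Differentiability of \<open>A\<close> and \<open>F\<close> in the parameter is meant pointwise, for each
  fixed choice of the arguments in \<open>V\<close>.
\<close>

definition assumption_A2 ::
  "(real^'d::finite) set \<Rightarrow> (real^'d \<Rightarrow> 'v::real_inner \<Rightarrow> 'v \<Rightarrow> real) \<Rightarrow>
    (real^'d \<Rightarrow> 'v \<Rightarrow> real) \<Rightarrow> bool" where
  "assumption_A2 \<Theta> A F \<longleftrightarrow>
    (\<exists>dA dF.
      (\<forall>w v. C1_partials_on \<Theta> (\<lambda>\<theta>. A \<theta> w v) (\<lambda>j \<theta>. dA j \<theta> w v)) \<and>
      (\<forall>v. C1_partials_on \<Theta> (\<lambda>\<theta>. F \<theta> v) (\<lambda>j \<theta>. dF j \<theta> v)) \<and>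
      (\<forall>\<theta>\<in>\<Theta>. \<forall>j.
        (\<exists>\<rho>>0. \<forall>w v. dA j \<theta> w v \<le> \<rho> * norm w * norm v) \<and>
        bounded_linear (dF j \<theta>)))"

definition solves_state ::
  "('v \<Rightarrow> 'v \<Rightarrow> real) \<Rightarrow> ('v \<Rightarrow> real) \<Rightarrow> 'v set \<Rightarrow> 'v \<Rightarrow> bool" where
  "solves_state a f S u \<longleftrightarrow> u \<in> S \<and> (\<forall>v\<in>S. a u v = f v)"

text \<open>
  The adjoint problem transposes the bilinear form; \<open>g\<close> is the derivative of the
  potential at the corresponding state.
\<close>

definition solves_adjoint ::
  "('v \<Rightarrow> 'v \<Rightarrow> real) \<Rightarrow> ('v \<Rightarrow> real) \<Rightarrow> 'v set \<Rightarrow> 'v \<Rightarrow> bool" where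
  "solves_adjoint a g S \<psi> \<longleftrightarrow> \<psi> \<in> S \<and> (\<forall>w\<in>S. a w \<psi> = - g w)"

definition C_y ::
  "real^'s^'s \<Rightarrow> ('s::finite \<Rightarrow> 'v::real_normed_vector \<Rightarrow> real) \<Rightarrow> real^'s \<Rightarrow> real" where
  "C_y G ob y = spectral_norm (matrix_inv G) * obs_norm ob * norm y"

definition C_O :: "real^'s^'s \<Rightarrow> ('s::finite \<Rightarrow> 'v::real_normed_vector \<Rightarrow> real) \<Rightarrow> real" where
  "C_O G ob = spectral_norm (matrix_inv G) * (obs_norm ob)\<^sup>2"

definition C_u :: "('t \<Rightarrow> 'v::real_normed_vector \<Rightarrow> real) \<Rightarrow> ('t \<Rightarrow> real) \<Rightarrow> 't \<Rightarrow> real" where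
  "C_u F \<alpha> \<theta> = onorm (F \<theta>) / \<alpha> \<theta>"

text \<open>
  The corrected reduced basis potential, for the form \<open>a\<close>, the functional \<open>f\<close>,
  the reduced state \<open>u\<close> and the reduced adjoint \<open>\<psi>\<close> at one parameter value.
\<close>

definition corrected_potential ::
  "real^'s^'s \<Rightarrow> ('s::finite \<Rightarrow> 'v \<Rightarrow> real) \<Rightarrow> real^'s \<Rightarrow> ('v \<Rightarrow> 'v \<Rightarrow> real) \<Rightarrow>
    ('v \<Rightarrow> real) \<Rightarrow> 'v \<Rightarrow> 'v \<Rightarrow> real" where
  "corrected_potential G ob y a f u \<psi> = potential G ob y u + a u \<psi> - f \<psi>"

lemma inner_matrix_inv_sym:
  fixes G :: "real^'s^'s"
  assumes "sym_pos_def G"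
  shows "x \<bullet> (matrix_inv G *v z) = (matrix_inv G *v x) \<bullet> z"
proof -
  have tr: "transpose G = G" and pos: "\<And>x. x \<noteq> 0 \<Longrightarrow> x \<bullet> (G *v x) > 0"
    using assms by (auto simp: sym_pos_def_def)
  have "\<And>x. G *v x = 0 \<Longrightarrow> x = 0"
    using pos by (metis inner_zero_right less_irrefl)
  then have "invertible G"
    by (metis invertible_left_inverse matrix_left_invertible_ker)
  then have r: "G ** matrix_inv G = mat 1"
    unfolding invertible_def matrix_inv_def by (rule someI2_ex) simp
  have eq: "G *v (matrix_inv G *v z) = z" for z
    by (simp add: matrix_vector_mul_assoc r)
  have sym: "(G *v a) \<bullet> b = a \<bullet> (G *v b)" for a b
    by (metis dot_lmul_matrix tr transpose_matrix_vector)
  have "x \<bullet> (matrix_inv G *v z) = (G *v (matrix_inv G *v x)) \<bullet> (matrix_inv G *v z)"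
    by (simp only: eq)
  also have "\<dots> = (matrix_inv G *v x) \<bullet> (G *v (matrix_inv G *v z))"
    by (rule sym)
  also have "\<dots> = (matrix_inv G *v x) \<bullet> z"
    by (simp only: eq)
  finally show ?thesis .
qed

lemma potential_has_derivative:
  fixes ob :: "'s::finite \<Rightarrow> 'v::real_normed_vector \<Rightarrow> real"
  assumes "sym_pos_def G" and "\<And>i. bounded_linear (ob i)"
  shows "(potential G ob y has_derivative potential_deriv G ob y u) (at u)"
proof -
  have bl: "bounded_linear (observe ob)"
    unfolding observe_def
    by (subst bounded_linear_componentwise_iff)
      (auto simp: Basis_vec_def inner_axis assms(2))
  have d: "((\<lambda>u. y - observe ob u) has_derivative (\<lambda>w. - observe ob w)) (at u)"
    by (auto intro!: derivative_eq_intros bounded_linear_imp_has_derivative[OF bl])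
  have d2: "((\<lambda>u. matrix_inv G *v (y - observe ob u)) has_derivative
      (\<lambda>w. matrix_inv G *v (- observe ob w))) (at u)"
    by (rule bounded_linear.has_derivative[OF matrix_vector_mul_bounded_linear d])
  have "((\<lambda>u. (y - observe ob u) \<bullet> (matrix_inv G *v (y - observe ob u)) / 2) has_derivative
      (\<lambda>w. ((y - observe ob u) \<bullet> (matrix_inv G *v (- observe ob w))
        + (- observe ob w) \<bullet> (matrix_inv G *v (y - observe ob u))) / 2)) (at u)"
    by (rule bounded_linear.has_derivative[OF bounded_linear_divide has_derivative_inner[OF d d2]])
  moreover have "((y - observe ob u) \<bullet> (matrix_inv G *v (- observe ob w))
        + (- observe ob w) \<bullet> (matrix_inv G *v (y - observe ob u))) / 2
      = potential_deriv G ob y u w" for w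
  proof -
    have "(- observe ob w) \<bullet> (matrix_inv G *v (y - observe ob u))
        = (y - observe ob u) \<bullet> (matrix_inv G *v (- observe ob w))"
      by (metis inner_commute inner_matrix_inv_sym[OF assms(1)])
    moreover have "matrix_inv G *v (- observe ob w) = - (matrix_inv G *v observe ob w)"
      using matrix_vector_mult_scaleR[of "matrix_inv G" "-1" "observe ob w"] by simp
    ultimately show ?thesis by (simp add: potential_deriv_def)
  qed
  ultimately show ?thesis
    by (simp add: potential_def[abs_def])
qed

end

theory Submission
  imports Defs
begin

text \<open>
  The potential is quadratic, so its increments are exact:
  \<open>\<eta>(u\<^sub>h) - \<eta>(u\<^sub>r)\<close> is half the pairing of the sum of the two residuals
  with \<open>- O(e\<^sup>u)\<close>, and the a priori bound \<open>C\<^sub>u\<close> on both states gives the first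
  estimate. Expanded around \<open>u\<^sub>h\<close>, the increment is a first-order term, equal to
  \<open>- A(e\<^sup>u, \<psi>\<^sub>h)\<close> by the adjoint problem, minus a quadratic remainder. As
  \<open>F(\<psi>\<^sub>r) = A(u\<^sub>h, \<psi>\<^sub>r)\<close>, the correction adds \<open>A(e\<^sup>u, \<psi>\<^sub>r)\<close>, so what is
  left is \<open>- A(e\<^sup>u, e\<^sup>\<psi>)\<close> and the remainder.
\<close>

lemma obs_norm_nonneg: "0 \<le> obs_norm ob"
  unfolding obs_norm_def by (simp add: sum_nonneg)

lemma spectral_norm_nonneg: "0 \<le> spectral_norm M"
  unfolding spectral_norm_def by (intro onorm_pos_le matrix_vector_mul_bounded_linear)

lemma observe_diff:
  assumes "\<And>i. linear (ob i)"
  shows "observe ob (u - v) = observe ob u - observe ob v"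
  by (simp add: observe_def vec_eq_iff linear_diff[OF assms])

text \<open>Each component is bounded through its own dual norm; the Euclidean norm of these bounds
  is \<open>obs_norm ob * norm u\<close>, because \<open>obs_norm\<close> collects the dual norms in
  the \<ell>2 sense.\<close>

lemma norm_observe_le:
  assumes "\<And>i. bounded_linear (ob i)"
  shows "norm (observe ob u) \<le> obs_norm ob * norm u"
proof -
  have "norm (observe ob u) \<le> L2_set (\<lambda>i. onorm (ob i) * norm u) UNIV"
    unfolding norm_vec_def observe_def
    by (intro L2_set_mono) (simp_all add: onorm[OF assms, simplified])
  also have "\<dots> = obs_norm ob * norm u"
    by (simp add: L2_set_def obs_norm_def power_mult_distrib real_sqrt_mult
        flip: sum_distrib_right)
  finally show ?thesis .
qed

lemma abs_inner_matrix_le: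
  "\<bar>x \<bullet> (M *v z)\<bar> \<le> spectral_norm M * norm x * norm z"
proof -
  have "\<bar>x \<bullet> (M *v z)\<bar> \<le> norm x * norm (M *v z)"
    by (rule Cauchy_Schwarz_ineq2)
  also have "\<dots> \<le> norm x * (spectral_norm M * norm z)"
    unfolding spectral_norm_def
    by (intro mult_left_mono onorm matrix_vector_mul_bounded_linear) simp
  finally show ?thesis by (simp add: mult_ac)
qed

text \<open>Difference of squares: p.Mp - q.Mq = (p + q).M(p - q) for the residuals p at
  \<open>u\<close> and q at \<open>v\<close>, where the cross terms cancel because M =
  \<open>matrix_inv G\<close> is symmetric. The minus sign comes from p - q = -
  \<open>observe ob (u - v)\<close>.\<close>

lemma potential_diff:
  assumes "sym_pos_def G" "\<And>i. linear (ob i)"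
  shows "potential G ob y u - potential G ob y v =
    - (((y - observe ob u) + (y - observe ob v)) \<bullet> (matrix_inv G *v observe ob (u - v))) / 2"
proof -
  have "(y - observe ob v) \<bullet> (matrix_inv G *v (y - observe ob u))
      = (y - observe ob u) \<bullet> (matrix_inv G *v (y - observe ob v))"
    by (metis inner_commute inner_matrix_inv_sym[OF assms(1)])
  moreover have "observe ob (u - v) = (y - observe ob v) - (y - observe ob u)"
    by (simp add: observe_diff[OF assms(2)])
  ultimately show ?thesis
    by (simp only: potential_def matrix_vector_mult_diff_distrib inner_add_left inner_diff_right)
      (simp add: field_simps)
qed

text \<open>The residual at \<open>v\<close> is the one at \<open>u\<close> plus
  \<open>observe ob (u - v)\<close>, so the sum of residuals splits into twice the residual at
  \<open>u\<close>, which gives the derivative, and the quadratic term. The base point is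
  \<open>u\<close> so that the adjoint problem at the high-fidelity state applies.\<close>

lemma potential_expand:
  assumes "sym_pos_def G" "\<And>i. linear (ob i)"
  shows "potential G ob y u - potential G ob y v = potential_deriv G ob y u (u - v)
    - (observe ob (u - v) \<bullet> (matrix_inv G *v observe ob (u - v))) / 2"
proof -
  have "y - observe ob v = (y - observe ob u) + observe ob (u - v)"
    by (simp add: observe_diff[OF assms(2)])
  then show ?thesis
    unfolding potential_diff[OF assms] potential_deriv_def
    by (simp only: inner_add_left) (simp add: field_simps)
qed

text \<open>(A1) bounds the form only from above; the same bound at \<open>- w\<close> supplies the
  lower one.\<close>

lemma abs_bilinear_le:
  assumes "bilinear a" "\<And>w v. a w v \<le> c * norm w * norm v"
  shows "\<bar>a w v\<bar> \<le> c * norm w * norm v"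
  using assms(2)[of w v] assms(2)[of "- w" v] by (simp add: bilinear_lneg[OF assms(1)])

text \<open>The solution is itself an admissible test function, so coercivity gives
  \<open>c * (norm u)\<^sup>2 \<le> f u\<close>, and one factor \<open>norm u\<close> cancels unless
  it is zero. The bound does not depend on \<open>S\<close>, so it serves both the high-fidelity and
  the reduced state.\<close>

lemma norm_state_le:
  assumes "solves_state a f S u" and "0 < c" "c * (norm u)\<^sup>2 \<le> a u u" "bounded_linear f"
  shows "norm u \<le> onorm f / c"
proof (cases "u = 0")
  case True
  then show ?thesis
    using onorm_pos_le[OF assms(4)] assms(2) by simp
next
  case False
  have "a u u = f u"
    using assms(1) by (simp add: solves_state_def)
  also have "\<dots> \<le> onorm f * norm u"
    using onorm[OF assms(4), of u] by simp
  finally have "c * norm u * norm u \<le> onorm f * norm u"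
    using assms(3) by (simp add: power2_eq_square mult_ac)
  then show ?thesis
    using False assms(2) by (simp add: pos_le_divide_eq mult.commute)
qed

theorem lemma5p4:
  fixes \<Theta> :: "(real^'d::finite) set"
    and A :: "real^'d \<Rightarrow> 'v::{real_inner, complete_space} \<Rightarrow> 'v \<Rightarrow> real"
    and F :: "real^'d \<Rightarrow> 'v \<Rightarrow> real"
    and ob :: "'s::finite \<Rightarrow> 'v \<Rightarrow> real"
    and y :: "real^'s"
    and \<Gamma> :: "real^'s^'s"
    and \<alpha> \<gamma> :: "real^'d \<Rightarrow> real"
    and V_h V_r W_r :: "'v set"
    and u_h u_r \<psi>_h \<psi>_r :: "real^'d \<Rightarrow> 'v"
  assumes A_bilinear: "\<forall>\<theta>\<in>\<Theta>. bilinear (A \<theta>)"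
    and F_linear: "\<forall>\<theta>\<in>\<Theta>. linear (F \<theta>)"
    and ob_dual: "\<forall>i. bounded_linear (ob i)"
    and Gamma_spd: "sym_pos_def \<Gamma>"
    and A1: "assumption_A1 \<Theta> A F \<alpha> \<gamma>"
    and A2: "assumption_A2 \<Theta> A F"
    and V_h: "subspace V_h" "\<exists>B. finite B \<and> span B = V_h"
    and V_r: "subspace V_r" "V_r \<subseteq> V_h"
    and W_r: "subspace W_r" "W_r \<subseteq> V_h"
    and u_h: "\<forall>\<theta>\<in>\<Theta>. solves_state (A \<theta>) (F \<theta>) V_h (u_h \<theta>)"
    and \<psi>_h: "\<forall>\<theta>\<in>\<Theta>. solves_adjoint (A \<theta>) (potential_deriv \<Gamma> ob y (u_h \<theta>)) V_h (\<psi>_h \<theta>)"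
    and u_r: "\<forall>\<theta>\<in>\<Theta>. solves_state (A \<theta>) (F \<theta>) V_r (u_r \<theta>)"
    and \<psi>_r: "\<forall>\<theta>\<in>\<Theta>. solves_adjoint (A \<theta>) (potential_deriv \<Gamma> ob y (u_r \<theta>)) W_r (\<psi>_r \<theta>)"
  shows "\<forall>\<theta>\<in>\<Theta>.
    \<bar>potential \<Gamma> ob y (u_h \<theta>) - potential \<Gamma> ob y (u_r \<theta>)\<bar>
      \<le> (C_y \<Gamma> ob y + C_O \<Gamma> ob * C_u F \<alpha> \<theta>) * norm (u_h \<theta> - u_r \<theta>) \<and>
    \<bar>potential \<Gamma> ob y (u_h \<theta>)
        - corrected_potential \<Gamma> ob y (A \<theta>) (F \<theta>) (u_r \<theta>) (\<psi>_r \<theta>)\<bar>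
      \<le> \<gamma> \<theta> * norm (u_h \<theta> - u_r \<theta>) * norm (\<psi>_h \<theta> - \<psi>_r \<theta>)
        + 1 / 2 * C_O \<Gamma> ob * (norm (u_h \<theta> - u_r \<theta>))\<^sup>2"
proof
  fix \<theta>
  assume t: "\<theta> \<in> \<Theta>"
  let ?S = "spectral_norm (matrix_inv \<Gamma>)" and ?O = "obs_norm ob" and ?U = "C_u F \<alpha> \<theta>"
  let ?e = "u_h \<theta> - u_r \<theta>"
  have bl: "bounded_linear (ob i)" for i
    using ob_dual by simp
  then have lin: "linear (ob i)" for i
    by (rule bounded_linear.linear)
  have bil: "bilinear (A \<theta>)"
    using A_bilinear t by blast
  have \<alpha>: "\<alpha> \<theta> > 0" and coer: "\<And>w. \<alpha> \<theta> * (norm w)\<^sup>2 \<le> A \<theta> w w"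
    and cont: "\<And>w v. A \<theta> w v \<le> \<gamma> \<theta> * norm w * norm v"
    and F: "bounded_linear (F \<theta>)"
    using A1 t by (auto simp: assumption_A1_def)
  have sh: "solves_state (A \<theta>) (F \<theta>) V_h (u_h \<theta>)"
    and sr: "solves_state (A \<theta>) (F \<theta>) V_r (u_r \<theta>)"
    and ah: "solves_adjoint (A \<theta>) (potential_deriv \<Gamma> ob y (u_h \<theta>)) V_h (\<psi>_h \<theta>)"
    and ar: "solves_adjoint (A \<theta>) (potential_deriv \<Gamma> ob y (u_r \<theta>)) W_r (\<psi>_r \<theta>)"
    using t u_h u_r \<psi>_h \<psi>_r by blast+
  note nonneg = spectral_norm_nonneg[of "matrix_inv \<Gamma>"] obs_norm_nonneg[of ob]
  note obs = norm_observe_le[of ob, OF bl]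
  have res: "norm (y - observe ob u) \<le> norm y + ?O * ?U" if "norm u \<le> ?U" for u
    using norm_triangle_ineq4[of y "observe ob u"] obs[of u]
      mult_left_mono[OF that nonneg(2)] by linarith
  have uh: "norm (u_h \<theta>) \<le> ?U" and ur: "norm (u_r \<theta>) \<le> ?U"
    unfolding C_u_def using norm_state_le[OF sh \<alpha> coer F] norm_state_le[OF sr \<alpha> coer F] by auto
  \<comment> \<open>The factor 2 from the two residuals cancels the 1/2 of the potential.\<close>
  have sum: "norm ((y - observe ob (u_h \<theta>)) + (y - observe ob (u_r \<theta>)))
      \<le> 2 * (norm y + ?O * ?U)"
    using norm_triangle_le[OF add_mono[OF res[OF uh] res[OF ur]]] by simp
  have "\<bar>potential \<Gamma> ob y (u_h \<theta>) - potential \<Gamma> ob y (u_r \<theta>)\<bar>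
      \<le> ?S * norm ((y - observe ob (u_h \<theta>)) + (y - observe ob (u_r \<theta>)))
          * norm (observe ob ?e) / 2"
    unfolding potential_diff[OF Gamma_spd lin]
    using abs_inner_matrix_le by (simp only: abs_divide abs_minus) (simp add: divide_right_mono)
  \<comment> \<open>Chaining \<open>norm_ge_zero\<close> with \<open>sum\<close> shows that the
    bound on the residuals is nonnegative, as the monotonicity of products requires.\<close>
  also have "\<dots> \<le> ?S * (2 * (norm y + ?O * ?U)) * (?O * norm ?e) / 2"
    using sum obs[of ?e] nonneg order_trans[OF norm_ge_zero sum]
    by (intro divide_right_mono mult_mono mult_left_mono) auto
  also have "\<dots> = (C_y \<Gamma> ob y + C_O \<Gamma> ob * ?U) * norm ?e"
    by (simp add: C_y_def C_O_def power2_eq_square algebra_simps)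
  finally have first: "\<bar>potential \<Gamma> ob y (u_h \<theta>) - potential \<Gamma> ob y (u_r \<theta>)\<bar>
      \<le> (C_y \<Gamma> ob y + C_O \<Gamma> ob * ?U) * norm ?e" .

  \<comment> \<open>Since \<open>V_r \<subseteq> V_h\<close>, the state error may be used as a test
    function in the high-fidelity adjoint problem.\<close>
  have "?e \<in> V_h"
    using sh sr V_h(1) V_r(2) by (auto simp: solves_state_def intro: subspace_diff)
  then have adj: "potential_deriv \<Gamma> ob y (u_h \<theta>) ?e = - A \<theta> ?e (\<psi>_h \<theta>)"
    using ah by (simp add: solves_adjoint_def)
  \<comment> \<open>Likewise \<open>W_r \<subseteq> V_h\<close> lets \<psi>_r test the high-fidelity
    state problem, which turns the residual of the reduced state at \<psi>_r into
    \<open>A \<theta> ?e (\<psi>_r \<theta>)\<close>.\<close>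
  have state: "F \<theta> (\<psi>_r \<theta>) = A \<theta> (u_h \<theta>) (\<psi>_r \<theta>)"
    using sh ar W_r(2) by (auto simp: solves_state_def solves_adjoint_def)
  have "potential \<Gamma> ob y (u_h \<theta>)
        - corrected_potential \<Gamma> ob y (A \<theta>) (F \<theta>) (u_r \<theta>) (\<psi>_r \<theta>)
      = - A \<theta> ?e (\<psi>_h \<theta> - \<psi>_r \<theta>)
        - (observe ob ?e \<bullet> (matrix_inv \<Gamma> *v observe ob ?e)) / 2"
    using potential_expand[OF Gamma_spd lin, where y = y and u = "u_h \<theta>" and v = "u_r \<theta>"]
    by (simp add: corrected_potential_def state adj bilinear_lsub[OF bil] bilinear_rsub[OF bil])
  moreover have "\<bar>observe ob ?e \<bullet> (matrix_inv \<Gamma> *v observe ob ?e)\<bar>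
      \<le> C_O \<Gamma> ob * (norm ?e)\<^sup>2"
  proof -
    have "\<bar>observe ob ?e \<bullet> (matrix_inv \<Gamma> *v observe ob ?e)\<bar>
        \<le> ?S * norm (observe ob ?e) * norm (observe ob ?e)"
      by (rule abs_inner_matrix_le)
    also have "\<dots> \<le> ?S * (?O * norm ?e) * (?O * norm ?e)"
      using obs[of ?e] nonneg by (intro mult_mono mult_left_mono) auto
    finally show ?thesis
      by (simp add: C_O_def power2_eq_square mult_ac)
  qed
  moreover have "\<bar>A \<theta> ?e (\<psi>_h \<theta> - \<psi>_r \<theta>)\<bar> \<le> \<gamma> \<theta> * norm ?e * norm (\<psi>_h \<theta> - \<psi>_r \<theta>)"
    by (rule abs_bilinear_le[OF bil cont])
  ultimately have "\<bar>potential \<Gamma> ob y (u_h \<theta>)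
        - corrected_potential \<Gamma> ob y (A \<theta>) (F \<theta>) (u_r \<theta>) (\<psi>_r \<theta>)\<bar>
      \<le> \<gamma> \<theta> * norm ?e * norm (\<psi>_h \<theta> - \<psi>_r \<theta>) + 1 / 2 * C_O \<Gamma> ob * (norm ?e)\<^sup>2"
    by linarith
  with first show "\<bar>potential \<Gamma> ob y (u_h \<theta>) - potential \<Gamma> ob y (u_r \<theta>)\<bar>
      \<le> (C_y \<Gamma> ob y + C_O \<Gamma> ob * ?U) * norm ?e \<and>
    \<bar>potential \<Gamma> ob y (u_h \<theta>)
        - corrected_potential \<Gamma> ob y (A \<theta>) (F \<theta>) (u_r \<theta>) (\<psi>_r \<theta>)\<bar>
      \<le> \<gamma> \<theta> * norm ?e * norm (\<psi>_h \<theta> - \<psi>_r \<theta>) + 1 / 2 * C_O \<Gamma> ob * (norm ?e)\<^sup>2" ..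
qed

end
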